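(* Let $r\ge3$ and let $a_1,\dots,a_r\in\Omega$ be defined recursively by $a_1=(a_r,\mathrm{id})\sigma$, $a_2=(\mathrm{id},a_1)\sigma$, $a_i=(a_{i-1},\mathrm{id})$ for $3\le i\le r$, and let $G$ be the closed subgroup of $\Omega$ topologically generated by $a_1,\dots,a_r$. For $j\in\{1,\dots,r\}$ let $N_j$ be the topological closure of the subgroup of $G$ generated by all $G$-conjugates of the elements $a_\ell$ with $\ell\not\equiv j$ and $\ell\not\equiv j-1\pmod r$. Then for any $i\in\{1,\dots,r\}$, the natural homomorphism $$G\to G/N_i\times G/N_{i+1}\times\cdots\times G/N_{i+r-2}$$ is surjective, where indices of the $N_j$ are taken modulo $r$ in $\{1,\dots,r\}$.
   Context: $T$ is the regular rooted binary tree whose vertices are finite words over $\{0,1\}$; $\Omega=\mathrm{Aut}(T)$ with its profinite topology; automorphisms act on the right and $\gamma\gamma'$ means first $\gamma$ then $\gamma'$. Every $\gamma\in\Omega$ is written uniquely as $(\gamma_0,\gamma_1)\tau$ with $\tau\in\{\mathrm{id},\sigma\}$, meaning $(xv)\gamma=(x)\tau\,(v)\gamma_x$ for a letter $x$ and word $v$; $\sigma=(\mathrm{id},\mathrm{id})\sigma$ swaps the first letter. Multiplication: $(\gamma_0,\gamma_1)\tau\cdot(\gamma_0',\gamma_1')\tau'=(\gamma_0\gamma'_{(0)\tau},\gamma_1\gamma'_{(1)\tau})\tau\tau'$. *)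

theory Defs
  imports "HOL-Analysis.Analysis" "HOL-Algebra.Algebra" "HOL-Number_Theory.Cong"
begin

text \<open>
  The binary tree has vertex set \<^typ>\<open>bool list\<close>; \<^term>\<open>False\<close> is the letter 0 and
  \<^term>\<open>True\<close> is the letter 1, the first letter being the head of the list. The right
  action \<open>(v)\<gamma>\<close> is written \<open>\<gamma> v\<close>.
\<close>

type_synonym word = "bool list"

definition is_child :: "word \<Rightarrow> word \<Rightarrow> bool" where
  "is_child v u \<longleftrightarrow> (\<exists>x. v = u @ [x])"

definition tree_aut :: "(word \<Rightarrow> word) \<Rightarrow> bool" where
  "tree_aut \<gamma> \<longleftrightarrow> bij \<gamma> \<and> \<gamma> [] = [] \<and> (\<forall>u v. is_child (\<gamma> v) (\<gamma> u) \<longleftrightarrow> is_child v u)"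

text \<open>Automorphisms act on the right, so the product applies the left factor first.\<close>

definition Omega :: "(word \<Rightarrow> word) monoid" where
  "Omega = \<lparr>carrier = {\<gamma>. tree_aut \<gamma>}, monoid.mult = (\<lambda>\<gamma> \<gamma>'. \<gamma>' \<circ> \<gamma>), one = id\<rparr>"

text \<open>
  The profinite topology: the basic open sets are the cosets of the pointwise stabilizers of
  the finite subtrees of words of length at most \<open>n\<close>.
\<close>

definition Omega_top :: "(word \<Rightarrow> word) topology" where
  "Omega_top = topology_generated_by
     {{\<delta> \<in> carrier Omega. \<forall>v. length v \<le> n \<longrightarrow> \<delta> v = \<gamma> v} | \<gamma> n. \<gamma> \<in> carrier Omega}"

text \<open>
  \<open>wreath \<gamma>\<^sub>0 \<gamma>\<^sub>1 \<tau>\<close> is \<open>(\<gamma>\<^sub>0, \<gamma>\<^sub>1)\<tau>\<close>, where \<open>\<tau>\<close> is given by its action on the first letter: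
  \<^term>\<open>id\<close>, or \<^term>\<open>Not\<close> for \<open>\<sigma>\<close>.
\<close>

fun wreath :: "(word \<Rightarrow> word) \<Rightarrow> (word \<Rightarrow> word) \<Rightarrow> (bool \<Rightarrow> bool) \<Rightarrow> word \<Rightarrow> word" where
  "wreath \<gamma>0 \<gamma>1 \<tau> [] = []"
| "wreath \<gamma>0 \<gamma>1 \<tau> (x # v) = \<tau> x # (if x then \<gamma>1 v else \<gamma>0 v)"

definition is_gens :: "nat \<Rightarrow> (nat \<Rightarrow> word \<Rightarrow> word) \<Rightarrow> bool" where
  "is_gens r a \<longleftrightarrow>
     (\<forall>i\<in>{1..r}. a i \<in> carrier Omega) \<and>
     a 1 = wreath (a r) id Not \<and>
     a 2 = wreath id (a 1) Not \<and>
     (\<forall>i\<in>{3..r}. a i = wreath (a (i - 1)) id id)"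

definition top_gen :: "nat \<Rightarrow> (nat \<Rightarrow> word \<Rightarrow> word) \<Rightarrow> (word \<Rightarrow> word) monoid" where
  "top_gen r a = Omega\<lparr>carrier := Omega_top closure_of generate Omega (a ` {1..r})\<rparr>"

definition N_sub :: "nat \<Rightarrow> (nat \<Rightarrow> word \<Rightarrow> word) \<Rightarrow> nat \<Rightarrow> (word \<Rightarrow> word) set" where
  "N_sub r a j = (let G = top_gen r a in
     Omega_top closure_of generate G
       {inv\<^bsub>G\<^esub> g \<otimes>\<^bsub>G\<^esub> a l \<otimes>\<^bsub>G\<^esub> g | g l. g \<in> carrier G \<and> l \<in> {1..r} \<and>
          \<not> [int l = int j] (mod int r) \<and> \<not> [int l = int j - 1] (mod int r)})"

text \<open>The representative of \<open>k \<ge> 1\<close> modulo \<open>r\<close> in \<open>{1..r}\<close>.\<close>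

definition idx :: "nat \<Rightarrow> nat \<Rightarrow> nat" where
  "idx r k = (k - 1) mod r + 1"

text \<open>
  The recursion in \<^const>\<open>is_gens\<close> has exactly one solution, apart from the irrelevant values
  \<open>a i\<close> for \<open>i\<close> outside \<open>{1..r}\<close>.
\<close>

fun gen :: "nat \<Rightarrow> word \<Rightarrow> nat \<Rightarrow> word" where
  "gen r [] i = []"
| "gen r (x # v) i =
     (if i = 1 then (\<not> x) # (if x then v else gen r v r)
      else if i = 2 then (\<not> x) # (if x then gen r v 1 else v)
      else x # (if x then v else gen r v (i - 1)))"

lemma gen_Nil_iff: "gen r v i = [] \<longleftrightarrow> v = []"
  by (cases v) auto

lemma gen_inj: "gen r u i = gen r v i \<Longrightarrow> u = v"
proof (induction u arbitrary: v i)
  case Nil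
  then show ?case by (metis gen.simps(1) gen_Nil_iff)
next
  case (Cons x u)
  then show ?case by (cases v) (auto split: if_splits)
qed

lemma gen_surj: "\<exists>v. gen r v i = w"
proof (induction w arbitrary: i)
  case Nil
  then show ?case by (metis gen.simps(1))
next
  case (Cons y w)
  define p :: bool where "p = (if i = 1 \<or> i = 2 then \<not> y else y)"
  obtain v1 where "gen r v1 r = w" using Cons.IH by blast
  moreover obtain v2 where "gen r v2 1 = w" using Cons.IH by blast
  moreover obtain v3 where "gen r v3 (i - 1) = w" using Cons.IH by blast
  ultimately have "gen r (p # (if i = 1 then if p then w else v1
      else if i = 2 then if p then v2 else w else if p then w else v3)) i = y # w"
    by (simp add: p_def)
  then show ?case by blast
qed

lemma gen_is_child: "is_child (gen r v i) (gen r u i) \<longleftrightarrow> is_child v u"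
proof (induction v arbitrary: u i)
  case Nil
  then show ?case by (simp add: is_child_def)
next
  case (Cons x v)
  have Cons_iff: "is_child (x # v) (y # u) \<longleftrightarrow> x = y \<and> is_child v u"
    "is_child (x # v) [] \<longleftrightarrow> v = []" for x y u v
    by (auto simp: is_child_def)
  show ?case
    by (cases u) (auto simp: Cons_iff gen_Nil_iff Cons.IH)
qed

lemma tree_aut_gen: "tree_aut (\<lambda>v. gen r v i)"
  unfolding tree_aut_def bij_def inj_def surj_def
  using gen_inj gen_surj gen_is_child by (metis gen.simps(1))

lemma is_gens_exists:
  assumes "r \<ge> 3"
  shows "is_gens r (\<lambda>i v. gen r v i)"
proof -
  have "(\<lambda>v. gen r v 1) v = wreath (\<lambda>v. gen r v r) id Not v"
    "(\<lambda>v. gen r v 2) v = wreath id (\<lambda>v. gen r v 1) Not v"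
    "i \<in> {3..r} \<Longrightarrow> (\<lambda>v. gen r v i) v = wreath (\<lambda>v. gen r v (i - 1)) id id v" for i v
    by (cases v; simp)+
  then show ?thesis
    by (auto simp: is_gens_def Omega_def tree_aut_gen)
qed

lemma is_gens_unique:
  assumes "r \<ge> 3" and a: "is_gens r a" and "i \<in> {1..r}"
  shows "a i v = gen r v i"
  using assms(3)
proof (induction v arbitrary: i)
  case Nil
  then show ?case using a by (auto simp: is_gens_def Omega_def tree_aut_def)
next
  case (Cons x v)
  have IH: "a k v = gen r v k" if "1 \<le> k" "k \<le> r" for k
    using Cons.IH that by simp
  consider "i = 1" | "i = 2" | "i \<in> {3..r}" using Cons.prems by force
  then show ?case
  proof cases
    case 1
    have "a i (x # v) = wreath (a r) id Not (x # v)" using a 1 by (simp add: is_gens_def)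
    then show ?thesis using 1 assms(1) IH[of r] by simp
  next
    case 2
    have "a i (x # v) = wreath id (a 1) Not (x # v)" using a 2 unfolding is_gens_def by metis
    then show ?thesis using 2 assms(1) IH[of 1] by simp
  next
    case 3
    have "a i (x # v) = wreath (a (i - 1)) id id (x # v)" using a 3 unfolding is_gens_def by metis
    then show ?thesis using 3 IH[of "i - 1"] by auto
  qed
qed

end

theory Submission
  imports Defs
begin

text \<open>
  Index the generators cyclically. The recursion forces \<open>a\<^sub>1 \<cdots> a\<^sub>r = 1\<close>: the product \<open>c\<close> satisfies
  \<open>c = (a\<^sub>r c a\<^sub>r\<inverse>, 1)\<close>. All generators except \<open>a\<^bsub>k-1\<^esub>\<close> and \<open>a\<^sub>k\<close> die in \<open>G/N\<^sub>k\<close>, so there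
  \<open>a\<^bsub>k-1\<^esub> a\<^sub>k = 1\<close> and \<open>G/N\<^sub>k\<close> is topologically generated by \<open>a\<^sub>k\<close>. For \<open>i \<le> k \<le> i+r-2\<close> the
  element \<open>b\<^sub>k = a\<^sub>k a\<^bsub>k+1\<^esub> \<cdots> a\<^bsub>i+r-2\<^esub>\<close> is congruent to \<open>a\<^sub>k\<close> modulo \<open>N\<^sub>k\<close>, and it lies in every other
  \<open>N\<^sub>l\<close> of the list, because it contains both or none of the factors \<open>a\<^bsub>l-1\<^esub>\<close>, \<open>a\<^sub>l\<close>. By compactness
  the closure of the group generated by \<open>b\<^sub>k\<close> maps onto \<open>G/N\<^sub>k\<close>, while it is trivial in the
  other factors.
\<close>

section \<open>Products over intervals and surjectivity onto products of quotients\<close>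

text \<open>Generic in the monoid, so that the same product can be formed in \<open>Omega\<close>
  and in its subgroup \<open>G\<close>. The half-open range lets adjacent products
  concatenate.\<close>

definition interval_prod :: "('a, 'b) monoid_scheme \<Rightarrow> (nat \<Rightarrow> 'a) \<Rightarrow> nat \<Rightarrow> nat \<Rightarrow> 'a" where
  "interval_prod G A m n = foldr (\<lambda>k x. A k \<otimes>\<^bsub>G\<^esub> x) [m..<n] \<one>\<^bsub>G\<^esub>"

lemma interval_prod_empty: "n \<le> m \<Longrightarrow> interval_prod G A m n = \<one>\<^bsub>G\<^esub>"
  by (simp add: interval_prod_def)

lemma interval_prod_rec:
  "m < n \<Longrightarrow> interval_prod G A m n = A m \<otimes>\<^bsub>G\<^esub> interval_prod G A (Suc m) n"
  by (simp add: interval_prod_def upt_rec)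

lemma (in group) interval_prod_mem:
  assumes "subgroup H G" and "\<And>k. m \<le> k \<Longrightarrow> k < n \<Longrightarrow> A k \<in> H"
  shows "interval_prod G A m n \<in> H"
  using assms(2)
proof (induction "n - m" arbitrary: m)
  case 0
  then show ?case using subgroup.one_closed[OF assms(1)] by (simp add: interval_prod_empty)
next
  case (Suc d)
  then have "m < n" "d = n - Suc m" by auto
  with Suc show ?case
    by (simp add: interval_prod_rec[OF \<open>m < n\<close>] subgroup.m_closed[OF assms(1)])
qed

lemma (in group) interval_prod_closed:
  assumes "\<And>k. m \<le> k \<Longrightarrow> k < n \<Longrightarrow> A k \<in> carrier G"
  shows "interval_prod G A m n \<in> carrier G"
  using interval_prod_mem[OF subgroup_self assms] .

lemma (in group) interval_prod_split:
  assumes "m \<le> k" "k \<le> n" and A: "\<And>j. m \<le> j \<Longrightarrow> j < n \<Longrightarrow> A j \<in> carrier G"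
  shows "interval_prod G A m n = interval_prod G A m k \<otimes> interval_prod G A k n"
  using assms(1) A
proof (induction "k - m" arbitrary: m)
  case 0
  then show ?case using \<open>k \<le> n\<close> by (simp add: interval_prod_empty interval_prod_closed)
next
  case (Suc d)
  then have lt: "m < k" "d = k - Suc m" by auto
  with \<open>k \<le> n\<close> have "m < n" by simp
  have "interval_prod G A (Suc m) n = interval_prod G A (Suc m) k \<otimes> interval_prod G A k n"
    using Suc lt by simp
  moreover have "interval_prod G A (Suc m) k \<in> carrier G" "interval_prod G A k n \<in> carrier G"
    "A m \<in> carrier G"
    using Suc.prems lt \<open>k \<le> n\<close> by (auto intro!: interval_prod_closed)
  ultimately show ?case
    by (simp add: interval_prod_rec[OF \<open>m < n\<close>] interval_prod_rec[OF lt(1)] m_assoc)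
qed

lemma (in group) interval_prod_Suc:
  assumes "m \<le> n" and "\<And>j. m \<le> j \<Longrightarrow> j \<le> n \<Longrightarrow> A j \<in> carrier G"
  shows "interval_prod G A m (Suc n) = interval_prod G A m n \<otimes> A n"
proof -
  have "interval_prod G A m (Suc n) = interval_prod G A m n \<otimes> interval_prod G A n (Suc n)"
    using assms by (intro interval_prod_split) auto
  then show ?thesis using assms by (simp add: interval_prod_rec interval_prod_empty)
qed

text \<open>Moving the window one place moves its first factor to the end, and
  \<open>x y = 1\<close> implies \<open>y x = 1\<close> in a group. A relation over one period
  therefore holds for every later starting point.\<close>

lemma (in group) interval_prod_periodic_eq_one:
  assumes A: "\<And>k. A k \<in> carrier G" and per: "\<And>k. m \<le> k \<Longrightarrow> A (k + r) = A k"
    and one: "interval_prod G A m (m + r) = \<one>" and "m \<le> n" and "0 < r"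
  shows "interval_prod G A n (n + r) = \<one>"
  using \<open>m \<le> n\<close>
proof (induction n rule: dec_induct)
  case base
  then show ?case using one .
next
  case (step n)
  let ?P = "interval_prod G A (Suc n) (n + r)"
  have P: "?P \<in> carrier G" using A by (intro interval_prod_closed)
  have "A n \<otimes> ?P = \<one>"
    using step.IH \<open>0 < r\<close> by (simp add: interval_prod_rec)
  then have "?P \<otimes> A n = \<one>" using P A inv_comm by blast
  moreover have "interval_prod G A (Suc n) (Suc n + r) = ?P \<otimes> A (n + r)"
    using A \<open>0 < r\<close> by (simp add: interval_prod_Suc)
  ultimately show ?case using per step.hyps by simp
qed

section \<open>Cosets of normal subgroups and surjectivity onto products of quotients\<close>

lemma (in normal) rcoset_absorb_left:
  assumes "x \<in> H" "g \<in> carrier G"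
  shows "H #> (x \<otimes> g) = H #> g"
  using assms coset_mult_assoc[OF subset, of x g] coset_join2[OF _ subgroup_axioms assms(1)]
  by simp

lemma (in normal) rcoset_absorb_right:
  assumes "x \<in> H" "g \<in> carrier G"
  shows "H #> (g \<otimes> x) = H #> g"
proof -
  have "H #> (g \<otimes> x) = (H #> g) <#> (H #> \<one>)"
    using assms rcos_sum[of g x] coset_join2[OF _ subgroup_axioms assms(1)] coset_mult_one[OF subset]
    by simp
  also have "\<dots> = H #> g" using rcos_sum[OF assms(2) one_closed] assms(2) by simp
  finally show ?thesis .
qed

text \<open>Each \<open>B k\<close> meets every coset of \<open>N k\<close> but is invisible in the
  other quotients. Coordinates can thus be corrected one at a time, and a preimage arises as a
  product with one factor per coordinate.\<close>

lemma (in group) epi_product_quotients: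
  assumes fin: "finite I" and norm: "\<And>k. k \<in> I \<Longrightarrow> N k \<lhd> G"
    and sub: "\<And>k l. k \<in> I \<Longrightarrow> l \<in> I \<Longrightarrow> k \<noteq> l \<Longrightarrow> B k \<subseteq> N l"
    and B: "\<And>k g. k \<in> I \<Longrightarrow> g \<in> carrier G \<Longrightarrow> \<exists>h\<in>B k. h \<in> carrier G \<and> N k #> h = N k #> g"
  shows "(\<lambda>g. \<lambda>k\<in>I. N k #> g) \<in> epi G (product_group I (\<lambda>k. G Mod N k))"
proof -
  have Nsub: "subgroup (N k) G" if "k \<in> I" for k
    using norm[OF that] by (simp add: normal_imp_subgroup)
  have hom: "(\<lambda>g. \<lambda>k\<in>I. N k #> g) \<in> hom G (product_group I (\<lambda>k. G Mod N k))"
    by (rule homI)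
      (auto simp: FactGroup_def RCOSETS_def normal.rcos_sum[OF norm] fun_eq_iff restrict_def)
  have "\<exists>g\<in>carrier G. (\<lambda>k\<in>I. N k #> g) = f"
    if f: "f \<in> carrier (product_group I (\<lambda>k. G Mod N k))" for f
  proof -
    have f_coset: "\<exists>g\<in>carrier G. f k = N k #> g" if "k \<in> I" for k
      using f that by (auto simp: FactGroup_def RCOSETS_def PiE_iff)
    \<comment> \<open>The induction also keeps \<open>g\<close> trivial in the coordinates not yet
      treated. This is what allows a new factor to prescribe coordinate \<open>j\<close>
      freely.\<close>
    have "\<exists>g\<in>carrier G. (\<forall>k\<in>J. N k #> g = f k) \<and> (\<forall>k\<in>I - J. g \<in> N k)"
      if "finite J" "J \<subseteq> I" for J
      using that
    proof (induction J rule: finite_induct)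
      case empty
      then show ?case using subgroup.one_closed[OF Nsub] by (intro bexI[of _ \<one>]) auto
    next
      case (insert j J)
      then obtain g where g: "g \<in> carrier G" "\<forall>k\<in>J. N k #> g = f k" "\<forall>k\<in>I - J. g \<in> N k"
        by auto
      have j: "j \<in> I" using insert by simp
      obtain h where h: "h \<in> B j" "h \<in> carrier G" "N j #> h = f j"
        using f_coset[OF j] B[OF j] by metis
      have hN: "h \<in> N k" if "k \<in> I" "k \<noteq> j" for k using sub[OF j that(1)] h(1) that(2) by blast
      show ?case
      proof (intro bexI[of _ "h \<otimes> g"] conjI ballI)
        show "h \<otimes> g \<in> carrier G" using g h by simp
        show "h \<otimes> g \<in> N k" if "k \<in> I - insert j J" for k
          using that hN g(3) subgroup.m_closed[OF Nsub] by blast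
        show "N k #> (h \<otimes> g) = f k" if k: "k \<in> insert j J" for k
        proof (cases "k = j")
          case True
          \<comment> \<open>In the new coordinate the old element is absorbed; in the old
            coordinates the new factor \<open>h\<close> is absorbed.\<close>
          have "g \<in> N j" using g(3) j insert.hyps by blast
          then show ?thesis
            using True h(2,3) normal.rcoset_absorb_right[OF norm[OF j]] by simp
        next
          case False
          then have "k \<in> I" "k \<in> J" using k insert.prems by auto
          then show ?thesis using normal.rcoset_absorb_left[OF norm hN g(1)] g(2) False by auto
        qed
      qed
    qed
    from this[OF fin order.refl] obtain g where "g \<in> carrier G" "\<forall>k\<in>I. N k #> g = f k" by blast
    \<comment> \<open>Elements of the product group are extensional, so \<open>f\<close> agrees with
      the restricted map outside \<open>I\<close> as well.\<close>
    then show ?thesis using f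
      by (intro bexI[of _ g]) (auto simp: fun_eq_iff restrict_def PiE_iff extensional_def)
  qed
  moreover have "(\<lambda>g. \<lambda>k\<in>I. N k #> g) ` carrier G
      \<subseteq> carrier (product_group I (\<lambda>k. G Mod N k))"
    using hom_carrier[OF hom] .
  ultimately show ?thesis using hom unfolding epi_def by blast
qed

section \<open>Automorphisms of the tree and their topology\<close>

lemma is_child_length: "is_child v u \<Longrightarrow> length v = Suc (length u)"
  by (auto simp: is_child_def)

lemma tree_aut_length:
  assumes "tree_aut f" shows "length (f v) = length v"
proof (induction v rule: rev_induct)
  case Nil
  then show ?case using assms by (simp add: tree_aut_def)
next
  case (snoc x v)
  have "is_child (f (v @ [x])) (f v)"
    using assms unfolding tree_aut_def by (auto simp: is_child_def)
  then show ?case using snoc is_child_length by fastforce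
qed

lemma tree_aut_id: "tree_aut id"
  by (simp add: tree_aut_def)

lemma tree_aut_comp: "tree_aut f \<Longrightarrow> tree_aut g \<Longrightarrow> tree_aut (g \<circ> f)"
  by (auto simp: tree_aut_def bij_comp)

lemma tree_aut_inv:
  assumes "tree_aut f" shows "tree_aut (inv_into UNIV f)"
proof -
  have bij: "bij f" and child: "\<And>u v. is_child (f v) (f u) \<longleftrightarrow> is_child v u" and "f [] = []"
    using assms by (auto simp: tree_aut_def)
  have "is_child (inv_into UNIV f v) (inv_into UNIV f u) \<longleftrightarrow> is_child v u" for u v
    using child[of "inv_into UNIV f v" "inv_into UNIV f u"] bij
    by (simp add: bij_is_surj surj_f_inv_f)
  moreover have "inv_into UNIV f [] = []"
    using bij \<open>f [] = []\<close> by (metis bij_inv_eq_iff)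
  ultimately show ?thesis using bij by (simp add: tree_aut_def bij_imp_bij_inv)
qed

lemma carrier_Omega [simp]: "f \<in> carrier Omega \<longleftrightarrow> tree_aut f"
  by (simp add: Omega_def)

lemma mult_Omega [simp]: "f \<otimes>\<^bsub>Omega\<^esub> g = g \<circ> f"
  by (simp add: Omega_def)

lemma one_Omega [simp]: "\<one>\<^bsub>Omega\<^esub> = id"
  by (simp add: Omega_def)

lemma group_Omega: "group Omega"
proof (rule groupI)
  fix f assume "f \<in> carrier Omega"
  then have "tree_aut f" by simp
  then have "tree_aut (inv_into UNIV f)" "f \<circ> inv_into UNIV f = id"
    using tree_aut_inv[of f] surj_iff[THEN iffD1, of f]
    by (simp_all add: tree_aut_def bij_is_surj)
  then show "\<exists>g\<in>carrier Omega. g \<otimes>\<^bsub>Omega\<^esub> f = \<one>\<^bsub>Omega\<^esub>" by auto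
qed (auto simp: tree_aut_comp tree_aut_id comp_assoc)

text \<open>This is equality modulo the pointwise stabilizer of the words of length at most
  \<open>n\<close>. It replaces basic open sets in all approximation arguments below.\<close>

definition eq_upto :: "nat \<Rightarrow> (word \<Rightarrow> word) \<Rightarrow> (word \<Rightarrow> word) \<Rightarrow> bool" where
  "eq_upto n f g \<longleftrightarrow> (\<forall>v. length v \<le> n \<longrightarrow> f v = g v)"

lemma eq_upto_refl [simp]: "eq_upto n f f"
  by (simp add: eq_upto_def)

lemma eq_upto_sym: "eq_upto n f g \<Longrightarrow> eq_upto n g f"
  by (simp add: eq_upto_def)

lemma eq_upto_mono: "eq_upto n f g \<Longrightarrow> m \<le> n \<Longrightarrow> eq_upto m f g"
  by (simp add: eq_upto_def)

text \<open>Since \<open>f\<close> is applied first and preserves length, \<open>g\<close> and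
  \<open>g'\<close> are only compared on words that still have length at most
  \<open>n\<close>.\<close>

lemma eq_upto_mult:
  assumes "eq_upto n f f'" "eq_upto n g g'" "tree_aut f"
  shows "eq_upto n (f \<otimes>\<^bsub>Omega\<^esub> g) (f' \<otimes>\<^bsub>Omega\<^esub> g')"
  using assms tree_aut_length[OF assms(3)] by (auto simp: eq_upto_def) metis

lemma eq_upto_inv:
  assumes "eq_upto n f g" "tree_aut f" "tree_aut g"
  shows "eq_upto n (inv\<^bsub>Omega\<^esub> f) (inv\<^bsub>Omega\<^esub> g)"
proof -
  interpret group Omega by (rule group_Omega)
  have fi: "tree_aut (inv\<^bsub>Omega\<^esub> f)" and gi: "tree_aut (inv\<^bsub>Omega\<^esub> g)"
    using assms inv_closed[of f] inv_closed[of g] by simp_all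
  \<comment> \<open>The two products differ only in the middle factor, \<open>g\<close> against
    \<open>f\<close>; the first cancels to the inverse of \<open>f\<close>, the second to the
    inverse of \<open>g\<close>.\<close>
  have "eq_upto n ((inv\<^bsub>Omega\<^esub> f \<otimes>\<^bsub>Omega\<^esub> g) \<otimes>\<^bsub>Omega\<^esub> inv\<^bsub>Omega\<^esub> g)
      ((inv\<^bsub>Omega\<^esub> f \<otimes>\<^bsub>Omega\<^esub> f) \<otimes>\<^bsub>Omega\<^esub> inv\<^bsub>Omega\<^esub> g)"
    using assms fi by (intro eq_upto_mult eq_upto_sym[of n f g] eq_upto_refl) (simp_all add: tree_aut_comp)
  moreover have "(inv\<^bsub>Omega\<^esub> f \<otimes>\<^bsub>Omega\<^esub> g) \<otimes>\<^bsub>Omega\<^esub> inv\<^bsub>Omega\<^esub> g = inv\<^bsub>Omega\<^esub> f"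
    using assms fi gi by (simp add: m_assoc del: mult_Omega one_Omega)
  moreover have "(inv\<^bsub>Omega\<^esub> f \<otimes>\<^bsub>Omega\<^esub> f) \<otimes>\<^bsub>Omega\<^esub> inv\<^bsub>Omega\<^esub> g = inv\<^bsub>Omega\<^esub> g"
    using assms gi l_inv[of f] by simp
  ultimately show ?thesis by simp
qed

text \<open>Injectivity and the child relation involve two words at a time, so one approximating
  automorphism settles each instance. For surjectivity, a preimage of \<open>w\<close> under an
  automorphism has the length of \<open>w\<close> and so lies where \<open>f\<close> and
  \<open>h\<close> agree.\<close>

lemma tree_aut_limit:
  assumes "\<And>n. \<exists>f. tree_aut f \<and> eq_upto n f h"
  shows "tree_aut h"
proof -
  have ex: "\<exists>f. tree_aut f \<and> f u = h u \<and> f v = h v" for u v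
    using assms[of "max (length u) (length v)"] by (auto simp: eq_upto_def)
  have "inj h"
  proof (rule injI)
    fix u v assume "h u = h v"
    with ex[of u v] show "u = v" unfolding tree_aut_def by (metis bij_is_inj injD)
  qed
  moreover have "\<exists>v. h v = w" for w
  proof -
    obtain f where f: "tree_aut f" "eq_upto (length w) f h" using assms by blast
    then obtain v where "f v = w" by (metis tree_aut_def bij_is_surj surj_f_inv_f)
    then have "h v = w" using f tree_aut_length[OF f(1), of v] by (auto simp: eq_upto_def)
    then show ?thesis ..
  qed
  ultimately have "bij h" by (metis bijI surjI)
  moreover have "h [] = []" using ex[of "[]" "[]"] by (auto simp: tree_aut_def)
  moreover have "is_child (h v) (h u) \<longleftrightarrow> is_child v u" for u v
    using ex[of u v] by (auto simp: tree_aut_def) metis+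
  ultimately show ?thesis by (simp add: tree_aut_def)
qed

section \<open>The profinite topology and closures in terms of approximation at each level\<close>

lemma openin_Omega_top_nbhd:
  assumes "openin Omega_top U" "f \<in> U"
  shows "\<exists>n. \<forall>g. tree_aut g \<and> eq_upto n g f \<longrightarrow> g \<in> U"
proof -
  define \<B> where
    "\<B> = {{\<delta> \<in> carrier Omega. \<forall>v. length v \<le> n \<longrightarrow> \<delta> v = \<gamma> v} | \<gamma> n. \<gamma> \<in> carrier Omega}"
  have "generate_topology_on \<B> U"
    using assms(1) by (simp add: Omega_top_def \<B>_def openin_topology_generated_by_iff)
  then show ?thesis using assms(2)
  \<comment> \<open>The topology is given by generators, so the claim follows the generation of open
    sets; an intersection needs the larger of the two levels.\<close>
  proof (induction arbitrary: f rule: generate_topology_on.induct)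
    case Empty
    then show ?case by simp
  next
    case (Int U V)
    then obtain m n where
      "\<forall>g. tree_aut g \<and> eq_upto m g f \<longrightarrow> g \<in> U" "\<forall>g. tree_aut g \<and> eq_upto n g f \<longrightarrow> g \<in> V"
      by blast
    then show ?case
      by (intro exI[of _ "max m n"]) (meson IntI eq_upto_mono max.cobounded1 max.cobounded2)
  next
    case (UN K)
    then show ?case by (meson UnionE UnionI)
  next
    case (Basis U)
    then obtain \<gamma> n where U: "U = {\<delta> \<in> carrier Omega. \<forall>v. length v \<le> n \<longrightarrow> \<delta> v = \<gamma> v}"
      by (auto simp: \<B>_def)
    then show ?case using Basis.prems by (intro exI[of _ n]) (auto simp: eq_upto_def)
  qed
qed

lemma openin_Omega_top_ball:
  "tree_aut f \<Longrightarrow> openin Omega_top {g. tree_aut g \<and> eq_upto n g f}"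
  unfolding Omega_top_def
  by (rule topology_generated_by_Basis) (auto simp: eq_upto_def)

abbreviation Omega_closure :: "(word \<Rightarrow> word) set \<Rightarrow> (word \<Rightarrow> word) set" where
  "Omega_closure S \<equiv> Abstract_Topology.closure_of Omega_top S"

lemma in_closure_Omega_top_iff:
  assumes "S \<subseteq> carrier Omega"
  shows "f \<in> Omega_closure S \<longleftrightarrow> tree_aut f \<and> (\<forall>n. \<exists>s\<in>S. eq_upto n s f)"
proof
  assume f: "f \<in> Omega_closure S"
  then have "f \<in> topspace Omega_top" by (simp add: in_closure_of)
  then have "tree_aut f"
    by (auto simp: Omega_top_def topology_generated_by_topspace)
  moreover have "\<exists>s\<in>S. eq_upto n s f" for n
  proof -
    let ?U = "{g. tree_aut g \<and> eq_upto n g f}"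
    have "openin Omega_top ?U" "f \<in> ?U" using openin_Omega_top_ball \<open>tree_aut f\<close> by auto
    moreover have "\<exists>y. y \<in> S \<and> y \<in> U" if "f \<in> U" "openin Omega_top U" for U
      using f that by (simp add: in_closure_of)
    ultimately have "\<exists>y. y \<in> S \<and> y \<in> ?U" by (simp only:)
    then show ?thesis by blast
  qed
  ultimately show "tree_aut f \<and> (\<forall>n. \<exists>s\<in>S. eq_upto n s f)" by simp
next
  assume f: "tree_aut f \<and> (\<forall>n. \<exists>s\<in>S. eq_upto n s f)"
  then have "f \<in> topspace Omega_top"
    using openin_Omega_top_ball[of f 0] openin_subset by fastforce
  moreover have "\<exists>s. s \<in> S \<and> s \<in> U" if "f \<in> U" "openin Omega_top U" for U
    using openin_Omega_top_nbhd[OF that(2,1)] f assms by (metis carrier_Omega subsetD)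
  ultimately show "f \<in> Omega_closure S" by (auto simp: in_closure_of)
qed

lemma subset_closure_Omega_top:
  "S \<subseteq> carrier Omega \<Longrightarrow> S \<subseteq> Omega_closure S"
  using in_closure_Omega_top_iff[of S] eq_upto_refl carrier_Omega by blast

lemma subgroup_closure:
  assumes "subgroup H Omega"
  shows "subgroup (Omega_closure H) Omega"
proof -
  interpret group Omega by (rule group_Omega)
  note iff = in_closure_Omega_top_iff[OF subgroup.subset[OF assms]]
  have H: "tree_aut h" if "h \<in> H" for h using subgroup.mem_carrier[OF assms that] by simp
  show ?thesis
  proof (rule subgroupI)
    show "Omega_closure H \<subseteq> carrier Omega" by (auto simp: iff)
    show "Omega_closure H \<noteq> {}"
      using subset_closure_Omega_top subgroup.subset[OF assms] subgroup.one_closed[OF assms] by blast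
  next
    fix f assume f: "f \<in> Omega_closure H"
    then have "tree_aut (inv\<^bsub>Omega\<^esub> f)" using inv_closed[of f] by (simp add: iff)
    moreover have "\<exists>s\<in>H. eq_upto n s (inv\<^bsub>Omega\<^esub> f)" for n
    proof -
      obtain s where "s \<in> H" "eq_upto n s f" using f unfolding iff by blast
      then show ?thesis
        using f H eq_upto_inv subgroup.m_inv_closed[OF assms] unfolding iff by blast
    qed
    ultimately show "inv\<^bsub>Omega\<^esub> f \<in> Omega_closure H" by (simp add: iff)
  next
    fix f g assume fg: "f \<in> Omega_closure H" "g \<in> Omega_closure H"
    then have "tree_aut (f \<otimes>\<^bsub>Omega\<^esub> g)" by (simp add: iff tree_aut_comp)
    moreover have "\<exists>s\<in>H. eq_upto n s (f \<otimes>\<^bsub>Omega\<^esub> g)" for n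
    proof -
      obtain s t where "s \<in> H" "eq_upto n s f" "t \<in> H" "eq_upto n t g"
        using fg unfolding iff by blast
      then show ?thesis using H eq_upto_mult subgroup.m_closed[OF assms] by blast
    qed
    ultimately show "f \<otimes>\<^bsub>Omega\<^esub> g \<in> Omega_closure H" unfolding iff by blast
  qed
qed

text \<open>Sequential compactness of \<open>Omega\<close>, by a diagonal argument: nested infinite
  index sets \<open>I n\<close> are chosen so that all \<open>h k\<close> with \<open>k\<close> in
  \<open>I n\<close> agree up to level \<open>n\<close>.\<close>

lemma tree_aut_cluster_point:
  fixes h :: "nat \<Rightarrow> word \<Rightarrow> word"
  assumes h: "\<And>k. tree_aut (h k)"
  shows "\<exists>f. tree_aut f \<and> (\<forall>n. \<exists>k\<ge>n. eq_upto n (h k) f)"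
proof -
  define P where "P n I \<longleftrightarrow> infinite I \<and> (\<forall>k\<in>I. \<forall>l\<in>I. eq_upto n (h k) (h l))"
    for n and I :: "nat set"
  have refine: "\<exists>J. P n J \<and> J \<subseteq> I" if inf: "infinite I" for n and I :: "nat set"
  proof -
    \<comment> \<open>Automorphisms preserve length, so each restriction maps the finite set
      \<open>V\<close> into itself. Only finitely many restrictions occur, and one of them occurs
      for infinitely many indices.\<close>
    define V where "V = {v :: word. length v \<le> n}"
    have "finite V" using finite_lists_length_le[of "UNIV :: bool set" n] by (simp add: V_def)
    then have "finite (PiE V (\<lambda>_. V))" by (intro finite_PiE)
    moreover have "(\<lambda>k. restrict (h k) V) ` I \<subseteq> PiE V (\<lambda>_. V)"
      using tree_aut_length[OF h] by (intro image_subsetI restrict_PiE_iff[THEN iffD2]) (simp add: V_def)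
    ultimately have "finite ((\<lambda>k. restrict (h k) V) ` I)" by (rule rev_finite_subset)
    then obtain k0 where
      "infinite {k \<in> I. restrict (h k) V = restrict (h k0) V}"
      using pigeonhole_infinite[OF inf, of "\<lambda>k. restrict (h k) V"] by blast
    moreover have "eq_upto n (h k) (h l)"
      if "restrict (h k) V = restrict (h k0) V" "restrict (h l) V = restrict (h k0) V" for k l
      using that unfolding eq_upto_def by (metis V_def mem_Collect_eq restrict_apply)
    ultimately show ?thesis
      by (intro exI[of _ "{k \<in> I. restrict (h k) V = restrict (h k0) V}"]) (simp add: P_def)
  qed
  have "\<exists>I. \<forall>n. P n (I n) \<and> I (Suc n) \<subseteq> I n"
  proof (rule dependent_nat_choice)
    show "\<exists>I. P 0 I" using refine[of UNIV 0] by auto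
  next
    fix I n assume "P n I"
    then have "infinite I" by (simp add: P_def)
    then show "\<exists>J. P (Suc n) J \<and> J \<subseteq> I" by (rule refine)
  qed
  then obtain I where I: "\<And>n. P n (I n)" and "\<And>n. I (Suc n) \<subseteq> I n" by blast
  then have dec: "I n \<subseteq> I m" if "m \<le> n" for m n
    using lift_Suc_antimono_le[of I] that by blast
  \<comment> \<open>Any index in \<open>I (length v)\<close> would give the same value at
    \<open>v\<close>; the choice only picks one.\<close>
  define f where "f v = h (SOME k. k \<in> I (length v)) v" for v
  have some: "(SOME k. k \<in> I n) \<in> I n" for n
    using I[of n] by (metis P_def infinite_imp_nonempty some_in_eq)
  have eq: "eq_upto n (h k) f" if "k \<in> I n" for n k
    unfolding eq_upto_def
  proof (intro allI impI)
    fix v :: word assume "length v \<le> n"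
    then have "k \<in> I (length v)" using dec that by blast
    then have "eq_upto (length v) (h k) (h (SOME k. k \<in> I (length v)))"
      using I[of "length v"] some[of "length v"] unfolding P_def by blast
    then show "h k v = f v" unfolding f_def eq_upto_def by blast
  qed
  have "\<exists>k\<ge>n. eq_upto n (h k) f" for n
  proof -
    have "infinite (I n)" using I by (simp add: P_def)
    then obtain k where "k \<ge> n" "k \<in> I n" by (metis infinite_nat_iff_unbounded_le)
    then show ?thesis using eq by blast
  qed
  moreover from this have "tree_aut f" using h by (intro tree_aut_limit) blast
  ultimately show ?thesis by blast
qed

text \<open>A compactness argument: if the factors \<open>h n\<close> cluster at \<open>f\<close>,
  then along the same indices the factors \<open>x n\<close> approximate \<open>g\<close> times the
  inverse of \<open>f\<close>. An approximate factorization at every level thus becomes an exact one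
  in the closures.\<close>

lemma closure_mult_closure:
  assumes H: "H \<subseteq> carrier Omega" and N: "N \<subseteq> carrier Omega" and g: "tree_aut g"
    and approx: "\<And>n. \<exists>x\<in>N. \<exists>h\<in>H. eq_upto n (x \<otimes>\<^bsub>Omega\<^esub> h) g"
  shows "\<exists>x\<in>Omega_closure N. \<exists>h\<in>Omega_closure H. g = x \<otimes>\<^bsub>Omega\<^esub> h"
proof -
  interpret group Omega by (rule group_Omega)
  obtain x h where xh: "\<And>n. x n \<in> N" "\<And>n. h n \<in> H" "\<And>n. eq_upto n (x n \<otimes>\<^bsub>Omega\<^esub> h n) g"
    using approx by metis
  have aut: "tree_aut (x n)" "tree_aut (h n)" for n using xh H N carrier_Omega by blast+
  obtain f where f: "tree_aut f" "\<And>n. \<exists>k\<ge>n. eq_upto n (h k) f"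
    using tree_aut_cluster_point[of h] aut by blast
  have fi: "tree_aut (inv\<^bsub>Omega\<^esub> f)" using f(1) inv_closed[of f] by simp
  have "f \<in> Omega_closure H"
    using f xh(2) in_closure_Omega_top_iff[OF H] by blast
  moreover have "g \<otimes>\<^bsub>Omega\<^esub> inv\<^bsub>Omega\<^esub> f \<in> Omega_closure N"
  proof -
    have "eq_upto n (x k) (g \<otimes>\<^bsub>Omega\<^esub> inv\<^bsub>Omega\<^esub> f)" if "k \<ge> n" "eq_upto n (h k) f" for n k
    proof -
      have "eq_upto n ((x k \<otimes>\<^bsub>Omega\<^esub> h k) \<otimes>\<^bsub>Omega\<^esub> inv\<^bsub>Omega\<^esub> h k) (g \<otimes>\<^bsub>Omega\<^esub> inv\<^bsub>Omega\<^esub> f)"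
        using aut f(1) that eq_upto_mono[OF xh(3)]
        by (intro eq_upto_mult eq_upto_inv) (auto simp: tree_aut_comp)
      moreover have "(x k \<otimes>\<^bsub>Omega\<^esub> h k) \<otimes>\<^bsub>Omega\<^esub> inv\<^bsub>Omega\<^esub> h k = x k"
        using aut[of k] inv_closed[of "h k"] by (simp add: m_assoc del: mult_Omega one_Omega)
      ultimately show ?thesis by simp
    qed
    then have "\<exists>s\<in>N. eq_upto n s (g \<otimes>\<^bsub>Omega\<^esub> inv\<^bsub>Omega\<^esub> f)" for n
      using f(2) xh(1) by blast
    then show ?thesis
      using in_closure_Omega_top_iff[OF N] g fi by (simp add: tree_aut_comp)
  qed
  moreover have "g = (g \<otimes>\<^bsub>Omega\<^esub> inv\<^bsub>Omega\<^esub> f) \<otimes>\<^bsub>Omega\<^esub> f"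
    using g f(1) fi by (simp add: m_assoc del: mult_Omega one_Omega)
  ultimately show ?thesis by blast
qed

lemma normal_closure:
  assumes H: "subgroup H Omega" and closed: "Omega_closure H = H"
    and M: "M \<lhd> Omega\<lparr>carrier := H\<rparr>"
  shows "Omega_closure M \<lhd> Omega\<lparr>carrier := H\<rparr>"
proof -
  interpret group Omega by (rule group_Omega)
  interpret HG: group "Omega\<lparr>carrier := H\<rparr>" by (rule subgroup_imp_group[OF H])
  have subM: "subgroup M (Omega\<lparr>carrier := H\<rparr>)" using M by (rule normal_imp_subgroup)
  have subM': "subgroup M Omega" using incl_subgroup[OF H subM] .
  have aut: "tree_aut h" if "h \<in> H" for h using subgroup.mem_carrier[OF H that] by simp
  have "M \<subseteq> H" using subgroup.subset[OF subM] by simp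
  \<comment> \<open>Closedness of \<open>H\<close> keeps the closure of \<open>M\<close> inside
    \<open>H\<close>.\<close>
  then have le: "Omega_closure M \<subseteq> H" using closure_of_mono closed by metis
  note iff = in_closure_Omega_top_iff[OF subgroup.subset[OF subM']]
  show ?thesis
  proof (rule HG.normal_invI)
    show "subgroup (Omega_closure M) (Omega\<lparr>carrier := H\<rparr>)"
      using subgroup_incl[OF subgroup_closure[OF subM'] H le] .
  next
    fix g f assume "g \<in> carrier (Omega\<lparr>carrier := H\<rparr>)" and f: "f \<in> Omega_closure M"
    then have g: "g \<in> H" by simp
    have gi: "inv\<^bsub>Omega\<^esub> g \<in> H" using subgroup.m_inv_closed[OF H g] .
    have "tree_aut (g \<otimes>\<^bsub>Omega\<^esub> f \<otimes>\<^bsub>Omega\<^esub> inv\<^bsub>Omega\<^esub> g)"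
      using aut g gi f le by (auto intro!: tree_aut_comp)
    moreover have "\<exists>s\<in>M. eq_upto n s (g \<otimes>\<^bsub>Omega\<^esub> f \<otimes>\<^bsub>Omega\<^esub> inv\<^bsub>Omega\<^esub> g)" for n
    proof -
      obtain s where s: "s \<in> M" "eq_upto n s f" using f unfolding iff by blast
      have "g \<otimes>\<^bsub>Omega\<^esub> s \<otimes>\<^bsub>Omega\<^esub> inv\<^bsub>Omega\<^esub> g \<in> M"
        using normal.inv_op_closed2[OF M, of g s] g s(1) H by simp
      moreover have "tree_aut g" "tree_aut s" "tree_aut (g \<otimes>\<^bsub>Omega\<^esub> s)"
        using aut g s(1) \<open>M \<subseteq> H\<close> by (auto intro!: tree_aut_comp)
      then have "eq_upto n (g \<otimes>\<^bsub>Omega\<^esub> s \<otimes>\<^bsub>Omega\<^esub> inv\<^bsub>Omega\<^esub> g)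
          (g \<otimes>\<^bsub>Omega\<^esub> f \<otimes>\<^bsub>Omega\<^esub> inv\<^bsub>Omega\<^esub> g)"
        using s(2) by (intro eq_upto_mult eq_upto_refl)
      ultimately show ?thesis by blast
    qed
    ultimately have "g \<otimes>\<^bsub>Omega\<^esub> f \<otimes>\<^bsub>Omega\<^esub> inv\<^bsub>Omega\<^esub> g \<in> Omega_closure M"
      unfolding iff by blast
    then show "g \<otimes>\<^bsub>Omega\<lparr>carrier := H\<rparr>\<^esub> f \<otimes>\<^bsub>Omega\<lparr>carrier := H\<rparr>\<^esub> inv\<^bsub>Omega\<lparr>carrier := H\<rparr>\<^esub> g
        \<in> Omega_closure M"
      using m_inv_consistent[OF H g] by simp
  qed
qed

section \<open>The group of the recursion\<close>

locale recursive_gens =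
  fixes r :: nat and a :: "nat \<Rightarrow> word \<Rightarrow> word"
  assumes r: "r \<ge> 3" and gens: "is_gens r a"
begin

text \<open>The cyclic extension of the generators, so that products may run past the index
  \<open>r\<close> without reducing indices.\<close>

definition A :: "nat \<Rightarrow> word \<Rightarrow> word" where
  "A k = a (idx r k)"

lemma idx_range: "idx r k \<in> {1..r}"
  using r mod_less_divisor[of r "k - 1"] by (simp add: idx_def Suc_le_eq)

text \<open>Periodicity starts at 1: truncated subtraction gives \<open>idx r 0 = 1\<close>, whereas
  \<open>idx r r = r\<close>.\<close>

lemma idx_periodic: "1 \<le> k \<Longrightarrow> idx r (k + r) = idx r k"
  by (cases k) (simp_all add: idx_def)

lemma idx_in_period:
  assumes "1 \<le> k" "p \<in> {1..r}"
  obtains m where "k \<le> m" "m < k + r" "idx r m = p"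
proof -
  \<comment> \<open>The offset from \<open>k\<close> to the next index representing
    \<open>p\<close>, computed in the integers because \<open>p - k\<close> may be negative.\<close>
  define d where "d = nat ((int p - int k) mod int r)"
  have d: "int d = (int p - int k) mod int r" using r by (simp add: d_def)
  then have "d < r" using r pos_mod_bound[of "int r" "int p - int k"] by linarith
  have "int ((k + d - 1) mod r) = (int k - 1 + int d) mod int r"
    using assms(1) by (simp add: of_nat_mod of_nat_diff algebra_simps)
  also have "\<dots> = (int p - 1) mod int r"
    unfolding d mod_add_right_eq by simp
  also have "\<dots> = int p - 1" using assms(2) by (simp add: mod_pos_pos_trivial)
  finally have "idx r (k + d) = p" using assms(2) by (simp add: idx_def)
  then show thesis using that[of "k + d"] \<open>d < r\<close> by simp
qed

lemma tree_aut_A: "tree_aut (A k)"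
  using gens idx_range[of k] unfolding A_def is_gens_def by auto

lemma A_periodic: "1 \<le> k \<Longrightarrow> A (k + r) = A k"
  by (simp add: A_def idx_periodic)

lemma A_eq: "k \<in> {1..r} \<Longrightarrow> A k = a k"
  by (cases k) (simp_all add: A_def idx_def)

text \<open>Allows the generators to be listed from \<open>k\<close> on when working modulo
  \<open>N_k\<close>.\<close>

lemma image_gens:
  assumes "1 \<le> k"
  shows "a ` {1..r} = A ` {k..<k + r}"
proof (intro subset_antisym image_subsetI)
  fix p assume "p \<in> {1..r}"
  then obtain m where "k \<le> m" "m < k + r" "idx r m = p" using idx_in_period[OF assms] by metis
  then show "a p \<in> A ` {k..<k + r}" unfolding A_def by (intro image_eqI[of _ _ m]) auto
qed (use idx_range in \<open>simp add: A_def\<close>)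

text \<open>The two swaps in \<open>a_1 a_2\<close> cancel and leave \<open>(a_r a_1, id)\<close>.
  Each further factor \<open>a_(k+1) = (a_k, id)\<close> appends \<open>a_k\<close> to the first
  component.\<close>

lemma interval_prod_wreath:
  assumes "2 \<le> k" "k \<le> r"
  shows "interval_prod Omega A 1 (Suc k) =
    wreath (A r \<otimes>\<^bsub>Omega\<^esub> interval_prod Omega A 1 k) id id"
  using assms
proof (induction k rule: dec_induct)
  case base
  have "A 1 = wreath (A r) id Not" "A 2 = wreath id (A 1) Not"
    using gens r unfolding is_gens_def by (simp_all add: A_eq)
  then have "A 1 \<otimes>\<^bsub>Omega\<^esub> A 2 = wreath (A r \<otimes>\<^bsub>Omega\<^esub> A 1) id id"
    by (intro ext, rename_tac v, case_tac v) auto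
  moreover have "interval_prod Omega A 1 (Suc 2) = A 1 \<otimes>\<^bsub>Omega\<^esub> A 2"
    "interval_prod Omega A 1 2 = A 1"
    by (simp_all add: interval_prod_rec interval_prod_empty numeral_2_eq_2)
  ultimately show ?case by (simp only:)
next
  case (step k)
  interpret group Omega by (rule group_Omega)
  have aSuc: "A (Suc k) = wreath (A k) id id"
    using gens r step unfolding is_gens_def by (simp add: A_eq)
  have "interval_prod Omega A 1 (Suc (Suc k)) = interval_prod Omega A 1 (Suc k) \<otimes>\<^bsub>Omega\<^esub> A (Suc k)"
    using tree_aut_A by (intro interval_prod_Suc) auto
  also have "\<dots> = wreath (A r \<otimes>\<^bsub>Omega\<^esub> (interval_prod Omega A 1 k \<otimes>\<^bsub>Omega\<^esub> A k)) id id"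
    unfolding step.IH[OF Suc_leD[OF step.prems]] aSuc
    by (intro ext, rename_tac v, case_tac v) auto
  also have "interval_prod Omega A 1 k \<otimes>\<^bsub>Omega\<^esub> A k = interval_prod Omega A 1 (Suc k)"
    using tree_aut_A step by (intro interval_prod_Suc[symmetric]) auto
  finally show ?case .
qed

lemma interval_prod_eq_one: "interval_prod Omega A 1 (1 + r) = \<one>\<^bsub>Omega\<^esub>"
proof -
  interpret group Omega by (rule group_Omega)
  let ?Q = "interval_prod Omega A 1 r" and ?c = "interval_prod Omega A 1 (Suc r)"
  have c: "?c = ?Q \<otimes>\<^bsub>Omega\<^esub> A r"
    using tree_aut_A r by (intro interval_prod_Suc) auto
  have c_rec: "?c = wreath (A r \<otimes>\<^bsub>Omega\<^esub> ?Q) id id"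
    using r by (intro interval_prod_wreath) auto
  have "?c v = v" for v
  proof (induction "length v" arbitrary: v)
    case 0
    then show ?case unfolding c_rec by simp
  next
    case (Suc n)
    then obtain x u where v: "v = x # u" "length u = n" by (metis length_Suc_conv)
    \<comment> \<open>With \<open>c = Q a_r\<close> and \<open>c = (a_r Q, id)\<close>, the
      induction hypothesis is applied to \<open>A r u\<close>, which has the length of
      \<open>u\<close>. Cancelling \<open>A r\<close> shows that \<open>a_r Q\<close> fixes
      \<open>u\<close>.\<close>
    have "A r (?Q (A r u)) = A r u"
      using Suc.hyps(1)[of "A r u"] v(2) tree_aut_length[OF tree_aut_A] unfolding c by simp
    then have "?Q (A r u) = u"
      using tree_aut_A unfolding tree_aut_def by (metis bij_is_inj injD)
    then show ?case unfolding c_rec v(1) by simp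
  qed
  then show ?thesis by (auto simp: fun_eq_iff)
qed

section \<open>The closed group \<open>G\<close> and its normal subgroups \<open>N_j\<close>\<close>

abbreviation "G \<equiv> top_gen r a"

lemma gens_subset: "a ` {1..r} \<subseteq> carrier Omega"
  using gens by (auto simp: is_gens_def)

lemma subgroup_G: "subgroup (carrier G) Omega"
  using subgroup_closure[OF group.generate_is_subgroup[OF group_Omega gens_subset]]
  by (simp add: top_gen_def)

lemma G_eq: "G = Omega\<lparr>carrier := carrier G\<rparr>"
  by (simp add: top_gen_def)

lemma closed_G: "Omega_closure (carrier G) = carrier G"
  by (simp add: top_gen_def)

lemma group_G: "group G"
  using group.subgroup_imp_group[OF group_Omega subgroup_G] G_eq by simp

lemma mult_G: "x \<otimes>\<^bsub>G\<^esub> y = x \<otimes>\<^bsub>Omega\<^esub> y"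
  by (simp add: top_gen_def)

lemma one_G: "\<one>\<^bsub>G\<^esub> = \<one>\<^bsub>Omega\<^esub>"
  by (simp add: top_gen_def)

lemma interval_prod_G: "interval_prod G A = interval_prod Omega A"
  by (simp add: interval_prod_def fun_eq_iff mult_G one_G)

lemma A_in_G: "A k \<in> carrier G"
proof -
  have "A k \<in> generate Omega (a ` {1..r})"
    unfolding A_def using idx_range by (intro generate.incl imageI)
  then show ?thesis
    using subset_closure_Omega_top[OF group.generate_incl[OF group_Omega gens_subset]]
    by (auto simp: top_gen_def)
qed

lemma subgroup_Omega: "subgroup H G \<Longrightarrow> subgroup H Omega"
  using group.incl_subgroup[OF group_Omega subgroup_G] G_eq by simp

lemma N_normal: "N_sub r a j \<lhd> G"
proof -
  interpret G: group G by (rule group_G)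
  let ?S = "{inv\<^bsub>G\<^esub> g \<otimes>\<^bsub>G\<^esub> a l \<otimes>\<^bsub>G\<^esub> g | g l. g \<in> carrier G \<and> l \<in> {1..r} \<and>
          \<not> [int l = int j] (mod int r) \<and> \<not> [int l = int j - 1] (mod int r)}"
  have a_in_G: "a l \<in> carrier G" if "l \<in> {1..r}" for l using A_in_G[of l] A_eq[OF that] by simp
  have "generate G ?S \<lhd> G"
  proof (rule G.normal_generateI)
    show "?S \<subseteq> carrier G" using a_in_G by auto
  next
    fix h g assume "h \<in> ?S" and g: "g \<in> carrier G"
    then obtain k l where k: "h = inv\<^bsub>G\<^esub> k \<otimes>\<^bsub>G\<^esub> a l \<otimes>\<^bsub>G\<^esub> k" "k \<in> carrier G" and l: "l \<in> {1..r}"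
      "\<not> [int l = int j] (mod int r)" "\<not> [int l = int j - 1] (mod int r)" by blast
    \<comment> \<open>Conjugation permutes the generating set: it only changes the conjugating
      element from \<open>k\<close> to \<open>k\<close> times the inverse of
      \<open>g\<close>.\<close>
    have "g \<otimes>\<^bsub>G\<^esub> h \<otimes>\<^bsub>G\<^esub> inv\<^bsub>G\<^esub> g
        = inv\<^bsub>G\<^esub> (k \<otimes>\<^bsub>G\<^esub> inv\<^bsub>G\<^esub> g) \<otimes>\<^bsub>G\<^esub> a l \<otimes>\<^bsub>G\<^esub> (k \<otimes>\<^bsub>G\<^esub> inv\<^bsub>G\<^esub> g)"
      using g k a_in_G[OF l(1)] by (simp add: G.m_assoc G.inv_mult_group)
    moreover have "k \<otimes>\<^bsub>G\<^esub> inv\<^bsub>G\<^esub> g \<in> carrier G" using g k by simp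
    ultimately show "g \<otimes>\<^bsub>G\<^esub> h \<otimes>\<^bsub>G\<^esub> inv\<^bsub>G\<^esub> g \<in> ?S" using l by blast
  qed
  then have "Omega_closure (generate G ?S) \<lhd> Omega\<lparr>carrier := carrier G\<rparr>"
    using normal_closure[OF subgroup_G closed_G] G_eq by simp
  then show ?thesis using G_eq by (simp add: N_sub_def Let_def)
qed

lemma N_subgroup: "subgroup (N_sub r a j) G"
  using N_normal by (rule normal_imp_subgroup)

lemma closed_N: "Omega_closure (N_sub r a j) = N_sub r a j"
  by (simp add: N_sub_def Let_def)

text \<open>The bounds describe one period with the residues of \<open>l\<close> and
  \<open>l - 1\<close> removed, the latter being represented by \<open>l + r - 1\<close>.\<close>

lemma A_in_N:
  assumes "1 \<le> l" "l < m" "m < l + r - 1"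
  shows "A m \<in> N_sub r a (idx r l)"
proof -
  interpret G: group G by (rule group_G)
  let ?j = "idx r l" and ?p = "idx r m"
  let ?S = "{inv\<^bsub>G\<^esub> g \<otimes>\<^bsub>G\<^esub> a l \<otimes>\<^bsub>G\<^esub> g | g l. g \<in> carrier G \<and> l \<in> {1..r} \<and>
          \<not> [int l = int ?j] (mod int r) \<and> \<not> [int l = int ?j - 1] (mod int r)}"
  have cong: "[int (idx r k) = int k] (mod int r)" if "1 \<le> k" for k
    using that by (simp add: idx_def cong_def of_nat_mod of_nat_diff mod_simps)
  \<comment> \<open>Both \<open>m - l\<close> and \<open>m - (l - 1)\<close> lie strictly between 0
    and \<open>r\<close>, so neither is divisible by \<open>r\<close>.\<close>
  have not_cong: "\<not> [int m = int l] (mod int r)" "\<not> [int m = int l - 1] (mod int r)"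
    using assms zdvd_not_zless[of "int m - int l" "int r"]
      zdvd_not_zless[of "int m - (int l - 1)" "int r"]
    by (auto simp: cong_iff_dvd_diff)
  have "\<not> [int ?p = int ?j] (mod int r)"
    using not_cong(1) cong[of m] cong[of l] assms(1,2) by (meson cong_sym cong_trans less_imp_le order_trans)
  moreover have "\<not> [int ?p = int ?j - 1] (mod int r)"
    using not_cong(2) cong[of m] cong_diff[OF cong[of l] cong_refl[of 1]] assms(1,2)
    by (meson cong_sym cong_trans less_imp_le order_trans)
  moreover have "A m = inv\<^bsub>G\<^esub> \<one>\<^bsub>G\<^esub> \<otimes>\<^bsub>G\<^esub> a ?p \<otimes>\<^bsub>G\<^esub> \<one>\<^bsub>G\<^esub>"
    using A_in_G[of m] by (simp add: A_def)
  ultimately have "A m \<in> ?S" using idx_range G.one_closed by blast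
  moreover have "?S \<subseteq> carrier G"
    using A_in_G by (auto simp: A_eq[symmetric])
  then have "generate G ?S \<subseteq> carrier Omega"
    using G.generate_incl subgroup.subset[OF subgroup_G] by blast
  ultimately show ?thesis
    using subset_closure_Omega_top generate.incl[of "A m" ?S G] by (auto simp: N_sub_def Let_def)
qed

text \<open>The product over the period starting at \<open>l\<close> is trivial, and its last
  \<open>r - 2\<close> factors lie in \<open>N_(l+1)\<close>. The product of the first two is the
  inverse of the product of these.\<close>

lemma pair_in_N:
  assumes "1 \<le> l"
  shows "A l \<otimes>\<^bsub>G\<^esub> A (Suc l) \<in> N_sub r a (idx r (Suc l))"
proof -
  interpret G: group G by (rule group_G)
  let ?N = "N_sub r a (idx r (Suc l))" and ?P = "interval_prod G A (Suc (Suc l)) (l + r)"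
  have P: "?P \<in> ?N"
    using A_in_N by (intro G.interval_prod_mem[OF N_subgroup]) auto
  then have PG: "?P \<in> carrier G" using subgroup.mem_carrier[OF N_subgroup] by blast
  have "interval_prod G A 1 (1 + r) = \<one>\<^bsub>G\<^esub>"
    unfolding interval_prod_G one_G by (rule interval_prod_eq_one)
  then have "interval_prod G A l (l + r) = \<one>\<^bsub>G\<^esub>"
    using assms r by (intro G.interval_prod_periodic_eq_one[of A 1 r l] A_in_G A_periodic) simp_all
  then have "(A l \<otimes>\<^bsub>G\<^esub> A (Suc l)) \<otimes>\<^bsub>G\<^esub> ?P = \<one>\<^bsub>G\<^esub>"
    using r A_in_G PG by (simp add: interval_prod_rec G.m_assoc)
  then have "A l \<otimes>\<^bsub>G\<^esub> A (Suc l) = inv\<^bsub>G\<^esub> ?P"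
    using A_in_G PG by (intro G.inv_equality[symmetric]) auto
  then show ?thesis using subgroup.m_inv_closed[OF N_subgroup P] by simp
qed

section \<open>The elements \<open>b_k\<close> and their images in the quotients\<close>

definition b :: "nat \<Rightarrow> nat \<Rightarrow> word \<Rightarrow> word" where
  "b i k = interval_prod G A k (i + r - 1)"

lemma b_in_G: "b i k \<in> carrier G"
  unfolding b_def by (rule group.interval_prod_closed[OF group_G A_in_G])

lemma b_in_N:
  assumes "1 \<le> i" "k \<in> {i..i + r - 2}" "l \<in> {i..i + r - 2}" "k \<noteq> l"
  shows "b i k \<in> N_sub r a (idx r l)"
proof -
  interpret G: group G by (rule group_G)
  note sub = N_subgroup[of "idx r l"]
  show ?thesis
  proof (cases "l < k")
    case True
    \<comment> \<open>As \<open>l >= i\<close>, the last factor index \<open>i + r - 2\<close> is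
      below \<open>l + r - 1\<close>, so no factor has the residue of \<open>l\<close> or
      \<open>l - 1\<close>.\<close>
    then show ?thesis
      unfolding b_def using assms A_in_N by (intro G.interval_prod_mem[OF sub]) auto
  next
    case False
    \<comment> \<open>Here \<open>k <= l - 1\<close>, so both critical factors \<open>A l'\<close>
      and \<open>A l\<close> occur, side by side; the product is cut around this pair.\<close>
    then obtain l' where l': "l = Suc l'" "k \<le> l'" using assms(4) by (cases l) auto
    let ?R = "interval_prod G A (Suc l) (i + r - 1)"
    have left: "interval_prod G A k l' \<in> N_sub r a (idx r l)"
    proof (rule G.interval_prod_mem[OF sub])
      fix m assume "k \<le> m" "m < l'"
      \<comment> \<open>The indices left of the pair lie below \<open>l\<close>; adding one period
        moves them into the range of \<open>A_in_N\<close>.\<close>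
      then have "A (m + r) \<in> N_sub r a (idx r l)" using assms l' by (intro A_in_N) auto
      then show "A m \<in> N_sub r a (idx r l)" using A_periodic[of m] assms \<open>k \<le> m\<close> by simp
    qed
    have right: "?R \<in> N_sub r a (idx r l)"
      using assms A_in_N by (intro G.interval_prod_mem[OF sub]) auto
    have "b i k = interval_prod G A k l' \<otimes>\<^bsub>G\<^esub> interval_prod G A l' (i + r - 1)"
      unfolding b_def using assms l' A_in_G by (intro G.interval_prod_split) auto
    also have "interval_prod G A l' (i + r - 1) = A l' \<otimes>\<^bsub>G\<^esub> (A l \<otimes>\<^bsub>G\<^esub> ?R)"
      using assms r l' by (simp add: interval_prod_rec)
    also have "\<dots> = (A l' \<otimes>\<^bsub>G\<^esub> A l) \<otimes>\<^bsub>G\<^esub> ?R"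
      using A_in_G subgroup.mem_carrier[OF sub right] by (simp add: G.m_assoc)
    finally show ?thesis
      using left right pair_in_N[of l'] l' assms subgroup.m_closed[OF sub] by auto
  qed
qed

lemma b_rcoset:
  assumes "1 \<le> i" "k \<in> {i..i + r - 2}"
  shows "N_sub r a (idx r k) #>\<^bsub>G\<^esub> b i k = N_sub r a (idx r k) #>\<^bsub>G\<^esub> A k"
proof -
  interpret G: group G by (rule group_G)
  have "interval_prod G A (Suc k) (i + r - 1) \<in> N_sub r a (idx r k)"
    using assms A_in_N by (intro G.interval_prod_mem[OF N_subgroup]) auto
  moreover have "b i k = A k \<otimes>\<^bsub>G\<^esub> interval_prod G A (Suc k) (i + r - 1)"
    unfolding b_def using assms r by (intro interval_prod_rec) auto
  ultimately show ?thesis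
    using normal.rcoset_absorb_right[OF N_normal _ A_in_G] by simp
qed

text \<open>Modulo \<open>N_k\<close> every generator of \<open>G\<close> is a power of
  \<open>b_k\<close>, so the product of \<open>N_k\<close> with the cyclic group \<open>K\<close> is
  dense in \<open>G\<close>. Compactness turns density into an exact factorization with
  \<open>h\<close> in the closure of \<open>K\<close>, because \<open>N_k\<close> is closed.\<close>

lemma closure_generate_b_rcoset:
  assumes i: "1 \<le> i" and k: "k \<in> {i..i + r - 2}" and g: "g \<in> carrier G"
  shows "\<exists>h\<in>Omega_closure (generate G {b i k}). h \<in> carrier G \<and>
    N_sub r a (idx r k) #>\<^bsub>G\<^esub> h = N_sub r a (idx r k) #>\<^bsub>G\<^esub> g"
proof -
  interpret G: group G by (rule group_G)
  let ?N = "N_sub r a (idx r k)"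
  interpret N: normal ?N G by (rule N_normal)
  define K where "K = generate G {b i k}"
  have K: "subgroup K G" unfolding K_def using b_in_G by (intro G.generate_is_subgroup) auto
  \<comment> \<open>The preimage in \<open>G\<close> of the image of \<open>K\<close> in the
    quotient by \<open>N_k\<close>, that is, the product set of \<open>N_k\<close> and
    \<open>K\<close>.\<close>
  define M where "M = {f \<in> carrier G. \<exists>h\<in>K. ?N #>\<^bsub>G\<^esub> f = ?N #>\<^bsub>G\<^esub> h}"
  have M: "subgroup M G"
  proof (rule G.subgroupI)
    show "M \<subseteq> carrier G" by (auto simp: M_def)
    show "M \<noteq> {}" using subgroup.one_closed[OF K] by (auto simp: M_def)
  next
    fix f assume "f \<in> M"
    then obtain h where "f \<in> carrier G" "h \<in> K" "?N #>\<^bsub>G\<^esub> f = ?N #>\<^bsub>G\<^esub> h" by (auto simp: M_def)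
    then have "?N #>\<^bsub>G\<^esub> inv\<^bsub>G\<^esub> f = ?N #>\<^bsub>G\<^esub> inv\<^bsub>G\<^esub> h"
      using N.rcos_inv subgroup.mem_carrier[OF K] by metis
    then show "inv\<^bsub>G\<^esub> f \<in> M"
      using \<open>f \<in> carrier G\<close> subgroup.m_inv_closed[OF K \<open>h \<in> K\<close>] by (auto simp: M_def)
  next
    fix f f' assume "f \<in> M" "f' \<in> M"
    then obtain h h' where h: "f \<in> carrier G" "h \<in> K" "?N #>\<^bsub>G\<^esub> f = ?N #>\<^bsub>G\<^esub> h"
      "f' \<in> carrier G" "h' \<in> K" "?N #>\<^bsub>G\<^esub> f' = ?N #>\<^bsub>G\<^esub> h'" by (auto simp: M_def)
    then have "?N #>\<^bsub>G\<^esub> (f \<otimes>\<^bsub>G\<^esub> f') = ?N #>\<^bsub>G\<^esub> (h \<otimes>\<^bsub>G\<^esub> h')"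
      using N.rcos_sum subgroup.mem_carrier[OF K] by metis
    then show "f \<otimes>\<^bsub>G\<^esub> f' \<in> M"
      using h subgroup.m_closed[OF K h(2,5)] by (auto simp: M_def)
  qed
  have NM: "f \<in> M" if "f \<in> ?N" for f
  proof -
    have "?N #>\<^bsub>G\<^esub> f = ?N #>\<^bsub>G\<^esub> \<one>\<^bsub>G\<^esub>"
      using that N.rcoset_absorb_left[OF that G.one_closed] N.mem_carrier[OF that] by simp
    then show ?thesis
      using N.mem_carrier[OF that] subgroup.one_closed[OF K] by (auto simp: M_def)
  qed
  have "b i k \<in> K" unfolding K_def by (simp add: generate.incl)
  then have AkM: "A k \<in> M" using b_rcoset[OF i k] A_in_G by (auto simp: M_def)
  have "A m \<in> M" if m: "m \<in> {k..<k + r}" for m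
  proof -
    \<comment> \<open>In a period starting at \<open>k\<close>, the interior generators die modulo
      \<open>N_k\<close>. The last has the residue of \<open>k - 1\<close> and is inverse to
      \<open>A k\<close> there.\<close>
    consider "m = k" | "k < m" "m < k + r - 1" | "Suc m = k + r"
      using m by fastforce
    then show ?thesis
    proof cases
      case 1
      then show ?thesis using AkM by simp
    next
      case 2
      then show ?thesis using A_in_N[of k m] NM i k by auto
    next
      case 3
      have "A m \<otimes>\<^bsub>G\<^esub> A k \<in> ?N"
        using pair_in_N[of m] A_periodic[of k] idx_periodic[of k] 3 i k m by auto
      moreover have "A m = (A m \<otimes>\<^bsub>G\<^esub> A k) \<otimes>\<^bsub>G\<^esub> inv\<^bsub>G\<^esub> (A k)"
        using A_in_G by (simp add: G.m_assoc)
      ultimately show ?thesis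
        using NM AkM subgroup.m_closed[OF M] subgroup.m_inv_closed[OF M] by metis
    qed
  qed
  then have "a ` {1..r} \<subseteq> M" using image_gens[of k] i k by auto
  then have gen_M: "generate Omega (a ` {1..r}) \<subseteq> M"
    by (intro group.generate_subgroup_incl[OF group_Omega] subgroup_Omega[OF M])
  have KO: "K \<subseteq> carrier Omega" and NO: "?N \<subseteq> carrier Omega"
    using subgroup.subset[OF subgroup_Omega] K N_subgroup by blast+
  have "\<exists>x\<in>?N. \<exists>h\<in>K. eq_upto n (x \<otimes>\<^bsub>Omega\<^esub> h) g" for n
  proof -
    have "g \<in> Omega_closure (generate Omega (a ` {1..r}))" using g by (simp add: top_gen_def)
    then obtain s where s: "s \<in> M" "eq_upto n s g"
      using in_closure_Omega_top_iff[OF group.generate_incl[OF group_Omega gens_subset]] gen_M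
      by blast
    then obtain h where h: "s \<in> carrier G" "h \<in> K" "?N #>\<^bsub>G\<^esub> s = ?N #>\<^bsub>G\<^esub> h"
      by (auto simp: M_def)
    \<comment> \<open>Equality of cosets yields the factorization of the approximating element
      \<open>s\<close> that \<open>closure_mult_closure\<close> requires at level
      \<open>n\<close>.\<close>
    have "s \<in> ?N #>\<^bsub>G\<^esub> h"
      using G.rcos_self[OF h(1) N_subgroup] h(3) by blast
    then obtain x where "x \<in> ?N" "s = x \<otimes>\<^bsub>G\<^esub> h" by (auto simp: r_coset_def)
    then show ?thesis using s(2) h(2) mult_G by metis
  qed
  moreover have "tree_aut g" using subgroup.mem_carrier[OF subgroup_G g] by simp
  ultimately obtain x h where xh: "x \<in> ?N" "h \<in> Omega_closure K" "g = x \<otimes>\<^bsub>G\<^esub> h"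
    using closure_mult_closure[OF KO NO, of g] closed_N mult_G by metis
  have "K \<subseteq> carrier G" using subgroup.subset[OF K] .
  then have "h \<in> carrier G" using xh(2) closure_of_mono closed_G by blast
  then show ?thesis using xh N.rcoset_absorb_left[OF xh(1)] K_def by auto
qed

lemma closure_generate_b_subset:
  assumes "1 \<le> i" "k \<in> {i..i + r - 2}" "l \<in> {i..i + r - 2}" "k \<noteq> l"
  shows "Omega_closure (generate G {b i k}) \<subseteq> N_sub r a (idx r l)"
proof -
  have "generate G {b i k} \<subseteq> N_sub r a (idx r l)"
    using b_in_N[OF assms] by (intro group.generate_subgroup_incl[OF group_G _ N_subgroup]) simp
  then show ?thesis using closure_of_mono closed_N by metis
qed

end

theorem theorem7p4:
  fixes r i :: nat and a :: "nat \<Rightarrow> word \<Rightarrow> word"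
  assumes "r \<ge> 3"
    and "is_gens r a"
    and "i \<in> {1..r}"
  shows "(\<lambda>g. \<lambda>k\<in>{i..i + r - 2}. N_sub r a (idx r k) #>\<^bsub>top_gen r a\<^esub> g)
    \<in> epi (top_gen r a)
        (product_group {i..i + r - 2} (\<lambda>k. top_gen r a Mod N_sub r a (idx r k)))"
proof -
  interpret recursive_gens r a using assms by unfold_locales
  show ?thesis
  proof (rule group.epi_product_quotients[OF group_G,
        where B = "\<lambda>k. Omega_closure (generate (top_gen r a) {b i k})"])
    show "N_sub r a (idx r k) \<lhd> top_gen r a" for k by (rule N_normal)
  qed (use assms(3) closure_generate_b_subset closure_generate_b_rcoset in auto)
qed

end
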